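(* Assume that $Q$ and $\mathcal{P}_s$, $s\in S$, are compact. If every $p\in\mathcal{P}$ is unichain, then the constant-gain average-reward robust Bellman equation $$u^*(s)=\sup_{\phi\in Q}\inf_{p_s\in\mathcal{P}_s}\sum_{a\in A}\sum_{s'\in S}\phi(a)p_s(s'|a)\big[r(s,a)-\alpha^*+u^*(s')\big]\qquad\forall s\in S$$ has a solution $(u^*,\alpha^* )$ with $u^*:S\to\mathbb{R}$ and $\alpha^*\in[0,1]$.
   Context: $S$ (states) and $A$ (actions) are finite nonempty sets; $\mathrm{Prob}(E)$ is the set of probability distributions on a finite set $E$; $r:S\times A\to[0,1]$ is a reward function. $Q\subseteq\mathrm{Prob}(A)$ is nonempty. For each $s\in S$, $\mathcal{P}_s$ is a nonempty set of maps $p_s:A\to\mathrm{Prob}(S)$, written $p_s(s'|a)$; $\mathcal{P}=\prod_{s\in S}\mathcal{P}_s$, and $p\in\mathcal{P}$ is written $p(s'|s,a)=p_s(s'|a)$. Compactness is in the Euclidean topology. For $p\in\mathcal{P}$ and $\Delta:S\to Q$ (written $\Delta(a|s)$), $p_\Delta(s'|s)=\sum_{a\in A}p(s'|s,a)\Delta(a|s)$. A transition kernel $S\to\mathrm{Prob}(S)$ is unichain if it has only one closed recurrent class. A controlled kernel $p\in\mathcal{P}$ is unichain (under the stationary controller policy class $\{S\to Q\}$) if $p_\Delta$ is unichain for all $\Delta:S\to Q$. *)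

theory Defs
  imports "HOL-Analysis.Analysis"
begin

text \<open>
  States and actions are finite types \<open>'s\<close> and \<open>'a\<close>. Distributions are vectors and
  maps from actions to distributions are matrices, so that compactness refers to the
  Euclidean topology.
\<close>

definition Prob :: "(real ^ 'e) set" where
  "Prob = {q. (\<forall>x. 0 \<le> q $ x) \<and> (\<Sum>x\<in>UNIV. q $ x) = 1}"

text \<open>For \<open>ps \<in> action_kernels\<close>, the entry \<open>ps $ a $ s'\<close> is $p_s(s'|a)$.\<close>

definition action_kernels :: "(real ^ 's ^ 'a) set" where
  "action_kernels = {ps. \<forall>a. ps $ a \<in> Prob}"

text \<open>A kernel \<open>K\<close> on the states has \<open>K s t\<close> as the probability of moving from \<open>s\<close> to \<open>t\<close>.\<close>

definition induced_kernel ::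
  "('s \<Rightarrow> real ^ 's ^ 'a) \<Rightarrow> ('s \<Rightarrow> real ^ 'a) \<Rightarrow> 's \<Rightarrow> 's \<Rightarrow> real" where
  "induced_kernel p \<Delta> s s' = (\<Sum>a\<in>UNIV. p s $ a $ s' * \<Delta> s $ a)"

primrec nstep :: "('s::finite \<Rightarrow> 's \<Rightarrow> real) \<Rightarrow> nat \<Rightarrow> 's \<Rightarrow> 's \<Rightarrow> real" where
  "nstep K 0 s t = (if s = t then 1 else 0)"
| "nstep K (Suc n) s t = (\<Sum>x\<in>UNIV. K s x * nstep K n x t)"

definition accessible :: "('s::finite \<Rightarrow> 's \<Rightarrow> real) \<Rightarrow> 's \<Rightarrow> 's \<Rightarrow> bool" where
  "accessible K s t \<longleftrightarrow> (\<exists>n. nstep K n s t > 0)"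

definition communicating_class :: "('s::finite \<Rightarrow> 's \<Rightarrow> real) \<Rightarrow> 's set \<Rightarrow> bool" where
  "communicating_class K C \<longleftrightarrow> (\<exists>s. C = {t. accessible K s t \<and> accessible K t s})"

text \<open>
  \<open>first_passage K t n s\<close> is the probability that the chain started at \<open>s\<close> visits \<open>t\<close>
  at time \<open>n + 1\<close> and at none of the times \<open>1, \<dots>, n\<close>. The time shift makes
  \<open>\<Sum>n. first_passage K s n s\<close> the probability of ever returning to \<open>s\<close>.
\<close>

primrec first_passage :: "('s::finite \<Rightarrow> 's \<Rightarrow> real) \<Rightarrow> 's \<Rightarrow> nat \<Rightarrow> 's \<Rightarrow> real" where
  "first_passage K t 0 s = K s t"
| "first_passage K t (Suc n) s = (\<Sum>x\<in>UNIV - {t}. K s x * first_passage K t n x)"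

definition recurrent :: "('s::finite \<Rightarrow> 's \<Rightarrow> real) \<Rightarrow> 's \<Rightarrow> bool" where
  "recurrent K s \<longleftrightarrow> (\<lambda>n. first_passage K s n s) sums 1"

definition closed_recurrent_class :: "('s::finite \<Rightarrow> 's \<Rightarrow> real) \<Rightarrow> 's set \<Rightarrow> bool" where
  "closed_recurrent_class K C \<longleftrightarrow>
     communicating_class K C \<and> (\<forall>s\<in>C. recurrent K s) \<and> (\<forall>s\<in>C. \<forall>t. t \<notin> C \<longrightarrow> K s t = 0)"

definition unichain :: "('s::finite \<Rightarrow> 's \<Rightarrow> real) \<Rightarrow> bool" where
  "unichain K \<longleftrightarrow> (\<exists>!C. closed_recurrent_class K C)"

definition controlled_unichain ::
  "(real ^ 'a) set \<Rightarrow> ('s::finite \<Rightarrow> real ^ 's ^ 'a) \<Rightarrow> bool" where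
  "controlled_unichain Q p \<longleftrightarrow> (\<forall>\<Delta>\<in>UNIV \<rightarrow> Q. unichain (induced_kernel p \<Delta>))"

end

theory Submission
  imports Defs
begin

text \<open>
  Write \<open>T u s\<close> for the max-min over \<open>\<phi> \<in> Q\<close> and \<open>p\<^sub>s \<in> P s\<close> of the expected value of
  \<open>r s a + u s'\<close>. Since probabilities sum to one, the Bellman equation says
  \<open>T u = u + \<alpha>\<close>: an additive eigenvector of \<open>T\<close> is wanted. The proof lets a discount
  factor tend to one.

  For \<open>\<gamma> < 1\<close>, Brouwer's theorem gives a solution of \<open>T (\<gamma> u) = u\<close>. Subtracting its
  minimum leaves \<open>w \<ge> 0\<close> that vanishes somewhere, with \<open>T (\<gamma> w) = w + \<alpha>\<close> and
  \<open>\<alpha> \<in> [0,1]\<close> (\<open>topical_relative_values\<close>). If the vectors \<open>w\<close> stay bounded as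
  \<open>\<gamma>\<close> tends to one, a limit point solves the equation.

  The unichain hypothesis excludes the other case (\<open>relative_values_not_unbounded\<close>). By
  compactness the max-min is attained, so each value \<open>T u\<close> is \<open>\<rho> + K u\<close> with bounded \<open>\<rho>\<close>
  and with \<open>K\<close> in the compact set of induced kernels. Divide \<open>T (\<gamma> w) = w + \<alpha>\<close> by the
  norm of \<open>w\<close>: if the norms tended to infinity, \<open>\<rho>\<close> and \<open>\<alpha>\<close> would disappear and a limit
  \<open>x = K x\<close> would be left, harmonic for an induced kernel, of norm one, and with a zero
  entry. But the harmonic functions of a unichain kernel are constant
  (\<open>unichain_harmonic_const\<close>): the states where a harmonic function is maximal form an
  invariant set, as do those where it is minimal; each contains a closed recurrent class
  (\<open>invariant_set_contains_closed_recurrent_class\<close>), and there is only one such class.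
\<close>

section \<open>Closed recurrent classes of a finite stochastic kernel\<close>

definition stochastic :: "('s::finite \<Rightarrow> 's \<Rightarrow> real) \<Rightarrow> bool" where
  "stochastic K \<longleftrightarrow> (\<forall>s t. 0 \<le> K s t) \<and> (\<forall>s. (\<Sum>t\<in>UNIV. K s t) = 1)"

definition invariant_set :: "('s::finite \<Rightarrow> 's \<Rightarrow> real) \<Rightarrow> 's set \<Rightarrow> bool" where
  "invariant_set K F \<longleftrightarrow> (\<forall>s\<in>F. \<forall>t. t \<notin> F \<longrightarrow> K s t = 0)"

text \<open>
  A weighted average reaches an upper bound of its terms only if every term of positive
  weight reaches it. This makes two sets invariant below: the maxima of a harmonic function,
  and the states from which a target is most likely never reached.
\<close>
lemma average_at_maximum:
  assumes K: "stochastic K"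
    and le: "\<And>y. K x y > 0 \<Longrightarrow> w y \<le> M"
    and eq: "(\<Sum>y\<in>UNIV. K x y * w y) = M"
    and y: "K x y > 0"
  shows "w y = M"
proof -
  have nn: "0 \<le> K x z * (M - w z)" for z
    using le[of z] K unfolding stochastic_def
    by (metis diff_ge_0_iff_ge less_eq_real_def mult_eq_0_iff mult_nonneg_nonneg)
  have "(\<Sum>z\<in>UNIV. K x z * (M - w z)) = (\<Sum>z\<in>UNIV. K x z) * M - (\<Sum>z\<in>UNIV. K x z * w z)"
    by (simp add: right_diff_distrib sum_subtractf sum_distrib_right)
  also have "\<dots> = 0" using K eq by (simp add: stochastic_def)
  finally have "\<forall>z\<in>UNIV. K x z * (M - w z) = 0"
    by (subst (asm) sum_nonneg_eq_0_iff) (use nn in auto)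
  with y show ?thesis by (metis UNIV_I eq_iff_diff_eq_0 less_irrefl mult_eq_0_iff)
qed

lemma nstep_nonneg: "stochastic K \<Longrightarrow> 0 \<le> nstep K n s t"
  by (induction n arbitrary: s) (auto simp: stochastic_def intro!: sum_nonneg)

text \<open>
  The recursion for \<open>nstep\<close> adds steps at the front of a path; here one is added at its end.
\<close>
lemma nstep_extend:
  assumes K: "stochastic K"
  shows "nstep K n s x > 0 \<Longrightarrow> K x y > 0 \<Longrightarrow> nstep K (Suc n) s y > 0"
proof (induction n arbitrary: s)
  case 0
  then have "s = x" by (auto split: if_splits)
  with 0 show ?case by (simp add: if_distrib cong: if_cong)
next
  case (Suc n)
  from Suc.prems(1) have "0 < (\<Sum>z\<in>UNIV. K s z * nstep K n z x)" by simp
  then obtain z where "K s z * nstep K n z x > 0"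
    by (meson not_less sum_nonpos)
  then have z: "K s z > 0" "nstep K n z x > 0"
    using K nstep_nonneg[OF K, of n z x] by (auto simp: stochastic_def zero_less_mult_iff)
  have "0 < K s z * nstep K (Suc n) z y"
    using z Suc by (intro mult_pos_pos) auto
  also have "\<dots> \<le> (\<Sum>z\<in>UNIV. K s z * nstep K (Suc n) z y)"
    using K nstep_nonneg[OF K]
    by (intro member_le_sum) (auto simp: stochastic_def simp del: nstep.simps)
  finally show ?case by simp
qed

lemma invariant_set_accessible:
  assumes K: "stochastic K"
  shows "invariant_set K {t. accessible K s t}"
  unfolding invariant_set_def
proof (intro ballI allI impI)
  fix x y assume "x \<in> {t. accessible K s t}" "y \<notin> {t. accessible K s t}"
  then have "\<not> K x y > 0"
    using nstep_extend[OF K] unfolding accessible_def by blast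
  then show "K x y = 0" using K by (metis stochastic_def less_eq_real_def)
qed

lemma nstep_leave_invariant_set:
  assumes "invariant_set K C" "t \<notin> C"
  shows "s \<in> C \<Longrightarrow> nstep K n s t = 0"
proof (induction n arbitrary: s)
  case 0
  then show ?case using assms by auto
next
  case (Suc n)
  have "K s x * nstep K n x t = 0" for x
  proof (cases "x \<in> C")
    case True
    then show ?thesis by (simp add: Suc.IH)
  next
    case False
    then show ?thesis using assms(1) Suc.prems by (simp add: invariant_set_def)
  qed
  then show ?case unfolding nstep.simps by (intro sum.neutral) blast
qed

lemma invariant_set_contains_minimal:
  assumes "invariant_set K F" "F \<noteq> {}"
  obtains C where "C \<subseteq> F" "C \<noteq> {}" "invariant_set K C"
    "\<And>D. D \<subseteq> C \<Longrightarrow> D \<noteq> {} \<Longrightarrow> invariant_set K D \<Longrightarrow> D = C"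
proof -
  let ?I = "{D. D \<subseteq> F \<and> D \<noteq> {} \<and> invariant_set K D}"
  have I: "finite ?I" "?I \<noteq> {}" using assms by auto
  obtain C where C: "C \<in> ?I" "\<forall>D\<in>?I. D \<subseteq> C \<longrightarrow> C = D"
    by (rule bexE[OF finite_has_minimal[OF I]]) (rule that)
  show ?thesis
  proof (rule that)
    show "D = C" if "D \<subseteq> C" "D \<noteq> {}" "invariant_set K D" for D
      using C that by auto
  qed (use C in auto)
qed

text \<open>
  For a stochastic kernel this is the probability that the chain started at \<open>x\<close> avoids \<open>t\<close> at
  the times \<open>1, \<dots>, n\<close>.
\<close>
definition survival :: "('s::finite \<Rightarrow> 's \<Rightarrow> real) \<Rightarrow> 's \<Rightarrow> nat \<Rightarrow> 's \<Rightarrow> real" where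
  "survival K t n x = 1 - (\<Sum>k<n. first_passage K t k x)"

lemma survival_Suc:
  assumes K: "stochastic K"
  shows "survival K t (Suc n) x = (\<Sum>y\<in>UNIV - {t}. K x y * survival K t n y)"
proof -
  have "(\<Sum>k<Suc n. first_passage K t k x) =
      K x t + (\<Sum>k<n. \<Sum>y\<in>UNIV - {t}. K x y * first_passage K t k y)"
    by (subst sum.lessThan_Suc_shift) simp
  also have "\<dots> = K x t + (\<Sum>y\<in>UNIV - {t}. K x y * (\<Sum>k<n. first_passage K t k y))"
    by (subst sum.swap) (simp add: sum_distrib_left)
  moreover have "1 = K x t + (\<Sum>y\<in>UNIV - {t}. K x y)"
    using K by (subst sum.remove[symmetric]) (auto simp: stochastic_def)
  ultimately show ?thesis
    by (simp add: survival_def right_diff_distrib sum_subtractf)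
qed

lemma first_passage_nonneg: "stochastic K \<Longrightarrow> 0 \<le> first_passage K t n x"
  by (induction n arbitrary: x) (auto simp: stochastic_def intro!: sum_nonneg)

lemma survival_nonneg: "stochastic K \<Longrightarrow> 0 \<le> survival K t n x"
proof (induction n arbitrary: x)
  case 0
  then show ?case by (simp add: survival_def)
next
  case (Suc n)
  then show ?case
    by (subst survival_Suc) (auto simp: stochastic_def intro!: sum_nonneg)
qed

text \<open>
  The limit \<open>g\<close> of the survival probabilities averages, along \<open>K\<close>, the function that equals
  \<open>g\<close> off \<open>t\<close> and \<open>0\<close> at \<open>t\<close>. If its maximum \<open>M\<close> over \<open>C\<close> were positive, the states
  of \<open>C\<close> where it is attained could step only to each other and never to \<open>t\<close>. By minimality
  these states are all of \<open>C\<close>, and then removing \<open>t\<close> leaves a smaller invariant set, which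
  contains the successors of \<open>t\<close>. So \<open>M = 0\<close>, and the chain returns to \<open>t\<close> almost
  surely.
\<close>
lemma minimal_invariant_set_recurrent:
  assumes K: "stochastic K" and inv: "invariant_set K C"
    and min: "\<And>D. D \<subseteq> C \<Longrightarrow> D \<noteq> {} \<Longrightarrow> invariant_set K D \<Longrightarrow> D = C"
    and t: "t \<in> C"
  shows "recurrent K t"
proof -
  have pos: "K x y > 0" if "K x y \<noteq> 0" for x y
    using K that by (metis stochastic_def less_eq_real_def)
  have "decseq (\<lambda>n. survival K t n x)" for x
    using first_passage_nonneg[OF K] by (intro decseq_SucI) (simp add: survival_def)
  then have "\<exists>l. (\<lambda>n. survival K t n x) \<longlonglongrightarrow> l" for x
    using decseq_convergent[of "\<lambda>n. survival K t n x" 0] survival_nonneg[OF K] by metis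
  then obtain g where g: "\<And>x. (\<lambda>n. survival K t n x) \<longlonglongrightarrow> g x" by metis
  have g0: "0 \<le> g x" for x
    using g survival_nonneg[OF K] by (meson LIMSEQ_le_const)
  define w where "w y = (if y = t then 0 else g y)" for y
  have geq: "(\<Sum>y\<in>UNIV. K x y * w y) = g x" for x
  proof -
    have "(\<lambda>n. survival K t (Suc n) x) \<longlonglongrightarrow> (\<Sum>y\<in>UNIV - {t}. K x y * g y)"
      unfolding survival_Suc[OF K] by (intro tendsto_intros g)
    then have "g x = (\<Sum>y\<in>UNIV - {t}. K x y * g y)"
      using LIMSEQ_unique LIMSEQ_Suc[OF g] by blast
    also have "\<dots> = (\<Sum>y\<in>UNIV. K x y * w y)"
      by (subst sum.remove[of UNIV t]) (auto simp: w_def intro!: sum.cong)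
    finally show ?thesis by simp
  qed
  define M where "M = Max (g ` C)"
  have gM: "g y \<le> M" if "y \<in> C" for y using that by (auto simp: M_def)
  have "M \<in> g ` C" unfolding M_def using t by (intro Max_in) auto
  then obtain x0 where x0: "x0 \<in> C" "g x0 = M" by auto
  have "M = 0"
  proof (rule ccontr)
    assume "M \<noteq> 0"
    then have M: "M > 0" using g0[of x0] x0 by simp
    have step: "y \<in> C \<and> y \<noteq> t \<and> g y = M" if "x \<in> C" "g x = M" "K x y > 0" for x y
    proof -
      have C: "z \<in> C" if "K x z > 0" for z
        using inv that \<open>x \<in> C\<close> unfolding invariant_set_def by fastforce
      have "w y = M"
      proof (rule average_at_maximum[OF K _ _ that(3)])
        show "w z \<le> M" if "K x z > 0" for z
          using gM[OF C[OF that]] M by (simp add: w_def)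
      qed (use geq that in simp)
      with M C[OF that(3)] show ?thesis by (auto simp: w_def split: if_splits)
    qed
    have "invariant_set K {y\<in>C. g y = M}"
      unfolding invariant_set_def using step pos by blast
    then have CM: "{y\<in>C. g y = M} = C" using x0 by (intro min) auto
    then have all: "y \<in> C - {t}" if "x \<in> C" "K x y > 0" for x y using step that by blast
    have "\<exists>y. K t y \<noteq> 0"
      using K unfolding stochastic_def by (metis sum.neutral zero_neq_one)
    then have "C - {t} \<noteq> {}" using all pos t by blast
    moreover have "invariant_set K (C - {t})"
      unfolding invariant_set_def using all pos by blast
    ultimately have "C - {t} = C" by (intro min) auto
    then show False using t by blast
  qed
  then have "g t = 0" using g0[of t] gM[OF t] by simp
  then have "(\<lambda>n. 1 - survival K t n t) \<longlonglongrightarrow> 1 - 0"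
    using g[of t] by (intro tendsto_intros) auto
  then show ?thesis by (simp add: recurrent_def sums_def survival_def)
qed

text \<open>
  A minimal invariant subset will do: the set of states accessible from any of its points is
  again invariant, hence is the whole minimal set, so all its points communicate.
\<close>
lemma invariant_set_contains_closed_recurrent_class:
  assumes K: "stochastic K" and "invariant_set K F" "F \<noteq> {}"
  obtains C where "C \<subseteq> F" "C \<noteq> {}" "closed_recurrent_class K C"
proof -
  obtain C where C: "C \<subseteq> F" "C \<noteq> {}" "invariant_set K C"
    and min: "\<And>D. D \<subseteq> C \<Longrightarrow> D \<noteq> {} \<Longrightarrow> invariant_set K D \<Longrightarrow> D = C"
    using invariant_set_contains_minimal assms(2,3) by blast
  have reach: "{t. accessible K s t} = C" if "s \<in> C" for s
  proof (rule min)
    show "{t. accessible K s t} \<subseteq> C"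
      using nstep_leave_invariant_set[OF C(3)] that unfolding accessible_def by force
    have "accessible K s s" unfolding accessible_def by (rule exI[of _ 0]) simp
    then show "{t. accessible K s t} \<noteq> {}" by blast
  qed (rule invariant_set_accessible[OF K])
  obtain s where "s \<in> C" using C by blast
  then have "C = {t. accessible K s t \<and> accessible K t s}" using reach by blast
  then have "communicating_class K C" unfolding communicating_class_def by blast
  moreover have "\<forall>s\<in>C. recurrent K s"
    using minimal_invariant_set_recurrent[OF K C(3) min] by blast
  ultimately show ?thesis
    using that C unfolding closed_recurrent_class_def invariant_set_def by blast
qed

lemma invariant_set_argmax:
  assumes K: "stochastic K" and harm: "\<And>s. (\<Sum>t\<in>UNIV. K s t * v t) = v s"
  shows "invariant_set K {s. v s = Max (range v)}"
  unfolding invariant_set_def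
proof (intro ballI allI impI)
  fix s t assume s: "s \<in> {s. v s = Max (range v)}" and t: "t \<notin> {s. v s = Max (range v)}"
  have "v t = Max (range v)" if "K s t > 0"
    by (rule average_at_maximum[OF K _ _ that]) (use harm[of s] s in auto)
  with t have "\<not> K s t > 0" by blast
  then show "K s t = 0" using K by (metis stochastic_def less_eq_real_def)
qed

text \<open>
  The maxima of \<open>v\<close> and those of \<open>-v\<close> each contain a closed recurrent class. There is only
  one, so some state is both a maximum and a minimum of \<open>v\<close>.
\<close>
lemma unichain_harmonic_const:
  assumes K: "stochastic K" and uni: "unichain K"
    and harm: "\<And>s. (\<Sum>t\<in>UNIV. K s t * v t) = v s"
  shows "v s = v t"
proof -
  have ne: "{s. f s = Max (range f)} \<noteq> {}" for f :: "'a \<Rightarrow> real"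
  proof -
    have "Max (range f) \<in> range f" by (intro Max_in) auto
    then show ?thesis by (metis (mono_tags, lifting) empty_iff mem_Collect_eq rangeE)
  qed
  obtain C where C: "C \<subseteq> {s. v s = Max (range v)}" "C \<noteq> {}" "closed_recurrent_class K C"
    using invariant_set_contains_closed_recurrent_class[OF K invariant_set_argmax[OF K harm] ne] by blast
  have "(\<Sum>t\<in>UNIV. K s t * - v t) = - v s" for s using harm[of s] by (simp add: sum_negf)
  from invariant_set_contains_closed_recurrent_class[OF K invariant_set_argmax[OF K this] ne]
  obtain D where D: "D \<subseteq> {s. - v s = Max (range (\<lambda>s. - v s))}" "D \<noteq> {}" "closed_recurrent_class K D"
    by blast
  have "C = D" using uni C D unfolding unichain_def by blast
  then obtain x where x: "v x = Max (range v)" "- v x = Max (range (\<lambda>s. - v s))"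
    using C D by blast
  have "v y = v x" for y
  proof (rule antisym)
    show "v y \<le> v x" unfolding x(1) by (rule Max_ge) auto
    have "- v y \<le> - v x" unfolding x(2) by (rule Max_ge) auto
    then show "v x \<le> v y" by simp
  qed
  then show ?thesis by metis
qed

section \<open>Values of compact max-min problems\<close>

text \<open>
  The value \<open>v\<close> of a max-min problem, described without suprema and infima: one choice of
  \<open>x\<close> guarantees \<open>v\<close>, and every choice can be held down to \<open>v\<close>. In this form attainment
  and monotonicity are immediate, and boundedness matters only in the translation back to
  \<open>SUP\<close> and \<open>INF\<close>.
\<close>
definition is_maxmin :: "'x set \<Rightarrow> 'y set \<Rightarrow> ('x \<Rightarrow> 'y \<Rightarrow> real) \<Rightarrow> real \<Rightarrow> bool" where
  "is_maxmin X Y G v \<longleftrightarrow>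
     (\<exists>x\<in>X. \<forall>y\<in>Y. v \<le> G x y) \<and> (\<forall>x\<in>X. \<exists>y\<in>Y. G x y \<le> v)"

lemma is_maxmin_attained:
  assumes "is_maxmin X Y G v"
  obtains x y where "x \<in> X" "y \<in> Y" "v = G x y"
proof -
  obtain x where x: "x \<in> X" "\<forall>y\<in>Y. v \<le> G x y" using assms unfolding is_maxmin_def by blast
  obtain y where y: "y \<in> Y" "G x y \<le> v" using assms x(1) unfolding is_maxmin_def by blast
  with x show ?thesis by (intro that[of x y]) (auto intro: order_antisym)
qed

lemma is_maxmin_mono:
  assumes "is_maxmin X Y G v" "is_maxmin X Y G' v'"
    and "\<And>x y. x \<in> X \<Longrightarrow> y \<in> Y \<Longrightarrow> G x y \<le> G' x y + e"
  shows "v \<le> v' + e"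
proof -
  obtain x where x: "x \<in> X" "\<forall>y\<in>Y. v \<le> G x y" using assms(1) unfolding is_maxmin_def by blast
  obtain y where y: "y \<in> Y" "G' x y \<le> v'" using assms(2) x(1) unfolding is_maxmin_def by blast
  have "v \<le> G x y" using x y by blast
  also have "\<dots> \<le> G' x y + e" using assms(3) x y by blast
  finally show ?thesis using y by simp
qed

lemma is_maxmin_SUP_INF:
  assumes "is_maxmin X Y G v" and bdd: "\<And>x. x \<in> X \<Longrightarrow> bdd_below (G x ` Y)"
  shows "(SUP x\<in>X. INF y\<in>Y. G x y) = v"
proof (rule cSup_eq_maximum)
  have up: "(INF y\<in>Y. G x y) \<le> v" if "x \<in> X" for x
    using assms that unfolding is_maxmin_def by (meson cINF_lower2)
  then show "z \<le> v" if "z \<in> (\<lambda>x. INF y\<in>Y. G x y) ` X" for z using that by auto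
  obtain x where x: "x \<in> X" "\<forall>y\<in>Y. v \<le> G x y" using assms(1) unfolding is_maxmin_def by blast
  have "Y \<noteq> {}" using assms(1) x(1) unfolding is_maxmin_def by blast
  then have "v \<le> (INF y\<in>Y. G x y)" using x by (intro cINF_greatest) auto
  with up[OF x(1)] have "v = (INF y\<in>Y. G x y)" by simp
  then show "v \<in> (\<lambda>x. INF y\<in>Y. G x y) ` X" using x(1) by blast
qed

text \<open>
  For fixed \<open>x\<close> the minimum \<open>f x\<close> over \<open>y\<close> is attained at some \<open>h x\<close>. The supremum of \<open>f\<close>
  is attained as well: along a convergent maximizing sequence \<open>c\<close>, the inequality
  \<open>f (c n) \<le> G (c n) y\<close> passes to the limit for each fixed \<open>y\<close>.
\<close>
lemma compact_maxmin_exists: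
  fixes G :: "'x::metric_space \<Rightarrow> 'y::metric_space \<Rightarrow> real"
  assumes X: "compact X" "X \<noteq> {}" and Y: "compact Y" "Y \<noteq> {}"
    and contX: "\<And>y. y \<in> Y \<Longrightarrow> continuous_on X (\<lambda>x. G x y)"
    and contY: "\<And>x. x \<in> X \<Longrightarrow> continuous_on Y (G x)"
  shows "\<exists>v. is_maxmin X Y G v"
proof -
  have "\<forall>x\<in>X. \<exists>y\<in>Y. \<forall>y'\<in>Y. G x y \<le> G x y'"
    using continuous_attains_inf[OF Y contY] by blast
  then obtain h where h: "\<And>x. x \<in> X \<Longrightarrow> h x \<in> Y" "\<And>x y. x \<in> X \<Longrightarrow> y \<in> Y \<Longrightarrow> G x (h x) \<le> G x y"
    by metis
  define f where "f x = G x (h x)" for x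
  obtain y0 where y0: "y0 \<in> Y" using Y by blast
  obtain xm where "\<And>x. x \<in> X \<Longrightarrow> G x y0 \<le> G xm y0"
    using continuous_attains_sup[OF X contX[OF y0]] by blast
  then have bdd: "bdd_above (f ` X)"
    using h(2)[OF _ y0] unfolding f_def by (intro bdd_aboveI2[where M = "G xm y0"]) (meson order_trans)
  define v where "v = (SUP x\<in>X. f x)"
  have up: "f x \<le> v" if "x \<in> X" for x unfolding v_def by (rule cSUP_upper[OF that bdd])
  have "\<exists>x\<in>X. v - 1 / real (Suc n) < f x" for n
    using less_cSUP_iff[OF X(2) bdd, of "v - 1 / real (Suc n)"] unfolding v_def[symmetric] by simp
  then obtain c where c: "\<And>n. c n \<in> X" "\<And>n. v - 1 / real (Suc n) < f (c n)" by metis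
  obtain x \<sigma> where x: "x \<in> X" "strict_mono \<sigma>" "(c \<circ> \<sigma>) \<longlonglongrightarrow> x"
    using X(1) c(1) unfolding compact_def by metis
  have "v \<le> G x y" if "y \<in> Y" for y
  proof (rule LIMSEQ_le)
    show "(\<lambda>n. G ((c \<circ> \<sigma>) n) y) \<longlonglongrightarrow> G x y"
      by (rule continuous_on_tendsto_compose[OF contX[OF that] x(3,1)]) (simp add: c)
    have "(\<lambda>n. 1 / real (Suc n)) \<longlonglongrightarrow> 0" using LIMSEQ_inverse_real_of_nat by (simp add: inverse_eq_divide)
    from LIMSEQ_subseq_LIMSEQ[OF this x(2)]
    show "(\<lambda>n. v - 1 / real (Suc (\<sigma> n))) \<longlonglongrightarrow> v"
      using tendsto_diff[OF tendsto_const, of _ 0 sequentially v] by (simp add: o_def)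
    have "v - 1 / real (Suc (\<sigma> n)) \<le> G ((c \<circ> \<sigma>) n) y" for n
      using c(2)[of "\<sigma> n"] h(2)[OF c(1) that, of "\<sigma> n"] by (simp add: f_def)
    then show "\<exists>N. \<forall>n\<ge>N. v - 1 / real (Suc (\<sigma> n)) \<le> G ((c \<circ> \<sigma>) n) y" by blast
  qed
  then have "is_maxmin X Y G v"
    using x(1) up h(1) unfolding is_maxmin_def f_def by blast
  then show ?thesis by blast
qed

section \<open>Additive eigenvectors of topical maps\<close>

text \<open>
  A topical map is monotone and commutes with the addition of constants. One inequality
  expresses both: monotonicity is the case \<open>e = 0\<close>, and homogeneity follows from \<open>e\<close> and
  \<open>-e\<close>.
\<close>
definition topical :: "(real ^ 's::finite \<Rightarrow> real ^ 's) \<Rightarrow> bool" where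
  "topical T \<longleftrightarrow> (\<forall>u w e. (\<forall>s. u $ s \<le> w $ s + e) \<longrightarrow> (\<forall>s. T u $ s \<le> T w $ s + e))"

lemma topicalD: "topical T \<Longrightarrow> (\<And>s. u $ s \<le> w $ s + e) \<Longrightarrow> T u $ s \<le> T w $ s + e"
  unfolding topical_def by blast

lemma topical_shift:
  assumes "topical T"
  shows "T (u - vec c) = T u - vec c"
proof -
  have "T (u - vec c) $ s = T u $ s - c" for s
    using topicalD[OF assms, of "u - vec c" u "- c" s] topicalD[OF assms, of u "u - vec c" c s]
    by simp
  then show ?thesis by (simp add: vec_eq_iff)
qed

text \<open>
  With the distance of the arguments as \<open>e\<close>, each component of a topical map is seen to be
  nonexpansive.
\<close>
lemma topical_continuous:
  fixes T :: "real ^ 's::finite \<Rightarrow> real ^ 's"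
  assumes "topical T"
  shows "continuous_on UNIV T"
proof -
  have comp: "T u $ s \<le> T w $ s + norm (u - w)" for u w s
  proof (rule topicalD[OF assms])
    show "u $ s \<le> w $ s + norm (u - w)" for s
      using component_le_norm_cart[of "u - w" s] by simp
  qed
  have "\<bar>T u $ s - T w $ s\<bar> \<le> dist u w" for u w s
    using comp[of u s w] comp[of w s u] by (simp add: dist_norm norm_minus_commute)
  then have "continuous_on UNIV (\<lambda>u. T u $ s)" for s
    unfolding continuous_on_iff dist_real_def by (meson le_less_trans)
  then have "continuous_on UNIV (\<lambda>u. \<chi> s. T u $ s)" by (rule continuous_on_vec_lambda)
  then show ?thesis by simp
qed

text \<open>
  The box is mapped into itself because \<open>1 + \<gamma> / (1 - \<gamma>) = 1 / (1 - \<gamma>)\<close>, so Brouwer's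
  theorem applies.
\<close>
lemma topical_discounted_fixed_point:
  fixes T :: "real ^ 's::finite \<Rightarrow> real ^ 's"
  assumes T: "topical T" and T0: "T 0 \<in> cbox 0 1" and g: "0 \<le> \<gamma>" "\<gamma> < 1"
  shows "\<exists>u\<in>cbox 0 (vec (1 / (1 - \<gamma>))). T (\<gamma> *\<^sub>R u) = u"
proof -
  let ?B = "cbox 0 (vec (1 / (1 - \<gamma>))) :: (real ^ 's) set"
  have "T (\<gamma> *\<^sub>R u) \<in> ?B" if u: "u \<in> ?B" for u
  proof -
    have us: "0 \<le> u $ s" "u $ s \<le> 1 / (1 - \<gamma>)" for s using u by (auto simp: mem_box_cart)
    have T0s: "0 \<le> T 0 $ s" "T 0 $ s \<le> 1" for s using T0 by (auto simp: mem_box_cart)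
    have "T 0 $ s \<le> T (\<gamma> *\<^sub>R u) $ s + 0" for s
      by (rule topicalD[OF T]) (use g us in simp)
    moreover have "T (\<gamma> *\<^sub>R u) $ s \<le> T 0 $ s + \<gamma> * (1 / (1 - \<gamma>))" for s
      by (rule topicalD[OF T]) (use mult_left_mono[OF us(2) g(1)] in simp)
    moreover have "1 + \<gamma> * (1 / (1 - \<gamma>)) = 1 / (1 - \<gamma>)" using g by (simp add: field_simps)
    ultimately have "0 \<le> T (\<gamma> *\<^sub>R u) $ s \<and> T (\<gamma> *\<^sub>R u) $ s \<le> 1 / (1 - \<gamma>)" for s
      using T0s[of s] by (smt (verit))
    then show ?thesis by (simp add: mem_box_cart)
  qed
  moreover have "0 \<in> ?B" using g by (simp add: mem_box_cart)
  moreover have "continuous_on ?B (\<lambda>u. T (\<gamma> *\<^sub>R u))"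
    by (rule continuous_on_compose2[OF topical_continuous[OF T]]) (auto intro!: continuous_intros)
  ultimately show ?thesis
    using brouwer[OF compact_cbox convex_box(1), of 0 "vec (1 / (1 - \<gamma>))" "\<lambda>u. T (\<gamma> *\<^sub>R u)"]
    by blast
qed

text \<open>
  With \<open>m\<close> the minimum of the discounted fixed point \<open>u\<close>, the vector \<open>w = u - m\<close> satisfies
  the equation with \<open>\<alpha> = (1 - \<gamma>) m\<close>; the bound on \<open>u\<close> is what keeps \<open>\<alpha>\<close> at most one. That
  \<open>w\<close> has a zero is stated as a vanishing product because this survives limits even when the
  position of the zero varies.
\<close>
lemma topical_relative_values:
  fixes T :: "real ^ 's::finite \<Rightarrow> real ^ 's"
  assumes T: "topical T" and T0: "T 0 \<in> cbox 0 1" and g: "0 \<le> \<gamma>" "\<gamma> < 1"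
  obtains w \<alpha> where "\<alpha> \<in> {0..1}" "\<And>s. 0 \<le> w $ s" "(\<Prod>s\<in>UNIV. w $ s) = 0"
    "T (\<gamma> *\<^sub>R w) = w + vec \<alpha>"
proof -
  obtain u where u: "u \<in> cbox 0 (vec (1 / (1 - \<gamma>)))" "T (\<gamma> *\<^sub>R u) = u"
    using topical_discounted_fixed_point[OF assms] by blast
  define m where "m = Min (range (($) u))"
  have "m \<in> range (($) u)" unfolding m_def by (rule Min_in) auto
  then obtain s0 where s0: "u $ s0 = m" by auto
  have mle: "m \<le> u $ s" for s unfolding m_def by (rule Min_le) auto
  have m: "0 \<le> m" "m \<le> 1 / (1 - \<gamma>)" using u(1) s0 by (auto simp: mem_box_cart)
  show ?thesis
  proof (rule that[of "(1 - \<gamma>) * m" "u - vec m"])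
    have "(1 - \<gamma>) * m \<le> (1 - \<gamma>) * (1 / (1 - \<gamma>))" using m g by (intro mult_left_mono) auto
    then show "(1 - \<gamma>) * m \<in> {0..1}" using m g by simp
    show "0 \<le> (u - vec m) $ s" for s using mle[of s] by simp
    show "(\<Prod>s\<in>UNIV. (u - vec m) $ s) = 0" using s0 by auto
    have "T (\<gamma> *\<^sub>R (u - vec m)) = T (\<gamma> *\<^sub>R u - vec (\<gamma> * m))"
      by (simp add: vec_scaleR scaleR_diff_right)
    also have "\<dots> = u - vec (\<gamma> * m)" using topical_shift[OF T] u(2) by simp
    also have "\<dots> = u - vec m + vec ((1 - \<gamma>) * m)" by (simp add: vec_eq_iff algebra_simps)
    finally show "T (\<gamma> *\<^sub>R (u - vec m)) = u - vec m + vec ((1 - \<gamma>) * m)" .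
  qed
qed

text \<open>
  Rescaling to unit norm removes the bounded terms \<open>\<rho>\<close> and \<open>\<alpha>\<close> in the limit. What
  remains is a fixed vector of some matrix in \<open>\<K>\<close>, constant by hypothesis. Having a zero entry,
  it vanishes, which contradicts its norm.
\<close>
lemma relative_values_not_unbounded:
  fixes T :: "real ^ 's::finite \<Rightarrow> real ^ 's" and \<K> :: "(real ^ 's ^ 's) set"
  assumes K: "compact \<K>"
    and affine: "\<And>u. \<exists>K\<in>\<K>. \<exists>\<rho>\<in>cbox 0 1. T u = \<rho> + K *v u"
    and const: "\<And>K v s t. K \<in> \<K> \<Longrightarrow> K *v v = v \<Longrightarrow> v $ s = v $ t"
    and g: "\<gamma> \<longlonglongrightarrow> 1"
    and a: "\<And>n. \<alpha> n \<in> {0..1}" and w0: "\<And>n s. 0 \<le> w n $ s" and wz: "\<And>n. (\<Prod>s\<in>UNIV. w n $ s) = 0"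
    and eq: "\<And>n. T (\<gamma> n *\<^sub>R w n) = w n + vec (\<alpha> n)"
    and big: "\<And>n. real n < norm (w n)"
  shows False
proof -
  have "\<exists>K \<rho>. K \<in> \<K> \<and> \<rho> \<in> cbox 0 1 \<and> T (\<gamma> n *\<^sub>R w n) = \<rho> + K *v (\<gamma> n *\<^sub>R w n)" for n
    using affine by blast
  then obtain K \<rho> where K\<rho>: "\<And>n. K n \<in> \<K>" "\<And>n. \<rho> n \<in> cbox 0 1"
    "\<And>n. T (\<gamma> n *\<^sub>R w n) = \<rho> n + K n *v (\<gamma> n *\<^sub>R w n)" by metis
  define v where "v n = w n /\<^sub>R norm (w n)" for n
  have nz: "norm (w n) > 0" for n using big[of n] by (meson le_less_trans of_nat_0_le_iff)
  have range: "(v n, K n) \<in> sphere 0 1 \<times> \<K>" for n using K\<rho>(1) nz[of n] by (simp add: v_def)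
  have cpt: "compact (sphere (0 :: real ^ 's) 1 \<times> \<K>)" using K by (intro compact_Times) auto
  obtain l \<sigma> where l: "l \<in> sphere 0 1 \<times> \<K>" and \<sigma>: "strict_mono \<sigma>"
    and lim: "((\<lambda>n. (v n, K n)) \<circ> \<sigma>) \<longlonglongrightarrow> l"
    by (rule seq_compactE[OF compact_imp_seq_compact[OF cpt] allI[OF range]])
  obtain x M where xM: "l = (x, M)" by (cases l)
  have vx: "(\<lambda>n. v (\<sigma> n)) \<longlonglongrightarrow> x" and KM: "(\<lambda>n. K (\<sigma> n)) \<longlonglongrightarrow> M"
    using tendsto_fst[OF lim] tendsto_snd[OF lim] by (simp_all add: xM o_def)
  have vs: "(\<lambda>n. v (\<sigma> n) $ s) \<longlonglongrightarrow> x $ s" for s by (intro tendsto_intros vx)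
  have g\<sigma>: "(\<lambda>n. \<gamma> (\<sigma> n)) \<longlonglongrightarrow> 1" using LIMSEQ_subseq_LIMSEQ[OF g \<sigma>] by (simp add: o_def)
  have small: "(\<lambda>n. (\<rho> (\<sigma> n) $ s - \<alpha> (\<sigma> n)) / norm (w (\<sigma> n))) \<longlonglongrightarrow> 0" for s
  proof (rule Lim_null_comparison)
    have "\<bar>(\<rho> (\<sigma> n) $ s - \<alpha> (\<sigma> n)) / norm (w (\<sigma> n))\<bar> \<le> 1 / real n" if "n > 0" for n
    proof -
      have "\<bar>\<rho> (\<sigma> n) $ s - \<alpha> (\<sigma> n)\<bar> \<le> 1"
        using K\<rho>(2)[of "\<sigma> n"] a[of "\<sigma> n"] by (simp add: mem_box_cart abs_le_iff) (smt (verit))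
      moreover have "real n \<le> norm (w (\<sigma> n))"
        using big[of "\<sigma> n"] seq_suble[OF \<sigma>, of n] by linarith
      ultimately have "\<bar>\<rho> (\<sigma> n) $ s - \<alpha> (\<sigma> n)\<bar> / norm (w (\<sigma> n)) \<le> 1 / real n"
        using that by (intro frac_le) auto
      then show ?thesis by simp
    qed
    then show "\<forall>\<^sub>F n in sequentially. norm ((\<rho> (\<sigma> n) $ s - \<alpha> (\<sigma> n)) / norm (w (\<sigma> n))) \<le> 1 / real n"
      by (intro eventually_mono[OF eventually_gt_at_top[of 0]]) simp
    show "(\<lambda>n. 1 / real n) \<longlonglongrightarrow> 0" by (rule lim_1_over_n)
  qed
  have "(M *v x) $ s = x $ s" for s
  proof -
    have "v n $ s = (\<rho> n $ s - \<alpha> n) / norm (w n) + \<gamma> n * (\<Sum>t\<in>UNIV. K n $ s $ t * v n $ t)" for n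
    proof -
      have "w n $ s + \<alpha> n = \<rho> n $ s + \<gamma> n * (\<Sum>t\<in>UNIV. K n $ s $ t * w n $ t)"
        using arg_cong[OF trans[OF eq[symmetric] K\<rho>(3)], of "\<lambda>z. z $ s" n]
        by (simp add: matrix_vector_mult_def sum_distrib_left mult_ac)
      then have "w n $ s / norm (w n) =
          (\<rho> n $ s - \<alpha> n + \<gamma> n * (\<Sum>t\<in>UNIV. K n $ s $ t * w n $ t)) / norm (w n)"
        by (simp add: algebra_simps)
      moreover have "(\<Sum>t\<in>UNIV. K n $ s $ t * v n $ t) = (\<Sum>t\<in>UNIV. K n $ s $ t * w n $ t) / norm (w n)"
        by (simp add: v_def sum_distrib_left divide_inverse mult_ac)
      moreover have "v n $ s = w n $ s / norm (w n)" by (simp add: v_def divide_inverse mult.commute)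
      ultimately show ?thesis by (simp add: add_divide_distrib)
    qed
    then have "(\<lambda>n. (\<rho> (\<sigma> n) $ s - \<alpha> (\<sigma> n)) / norm (w (\<sigma> n)) +
        \<gamma> (\<sigma> n) * (\<Sum>t\<in>UNIV. K (\<sigma> n) $ s $ t * v (\<sigma> n) $ t)) \<longlonglongrightarrow> x $ s"
      using vs[of s] by presburger
    moreover have "(\<lambda>n. (\<rho> (\<sigma> n) $ s - \<alpha> (\<sigma> n)) / norm (w (\<sigma> n)) +
        \<gamma> (\<sigma> n) * (\<Sum>t\<in>UNIV. K (\<sigma> n) $ s $ t * v (\<sigma> n) $ t))
        \<longlonglongrightarrow> 0 + 1 * (\<Sum>t\<in>UNIV. M $ s $ t * x $ t)"
      by (intro tendsto_intros small g\<sigma> KM vs)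
    ultimately show ?thesis using LIMSEQ_unique by (fastforce simp: matrix_vector_mult_def)
  qed
  then have "M *v x = x" by (simp add: vec_eq_iff)
  then have xc: "x $ s = x $ t" for s t using const l xM by auto
  have "(\<Prod>s\<in>UNIV. v n $ s) = 0" for n using wz[of n] nz[of n] by (auto simp: v_def)
  moreover have "(\<lambda>n. \<Prod>s\<in>UNIV. v (\<sigma> n) $ s) \<longlonglongrightarrow> (\<Prod>s\<in>UNIV. x $ s)"
    by (intro tendsto_prod vs)
  ultimately have "(\<lambda>n. 0) \<longlonglongrightarrow> (\<Prod>s\<in>UNIV. x $ s)" by (simp only:)
  then have "(\<Prod>s\<in>UNIV. x $ s) = 0" by (simp only: LIMSEQ_const_iff)
  then obtain s0 where "x $ s0 = 0" by auto
  with xc have "x = 0" by (metis vec_eq_iff zero_index)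
  with l xM show False by simp
qed

text \<open>
  The vanishing-discount limit, along \<open>\<gamma> n = 1 - 1 / Suc n\<close>. The hypothesis \<open>affine\<close> is
  how optimal actions and worst-case kernels enter; at \<open>u = 0\<close> it also confines \<open>T 0\<close> to the
  unit box.
\<close>
theorem topical_additive_eigenvector:
  fixes T :: "real ^ 's::finite \<Rightarrow> real ^ 's" and \<K> :: "(real ^ 's ^ 's) set"
  assumes T: "topical T" and K: "compact \<K>"
    and affine: "\<And>u. \<exists>K\<in>\<K>. \<exists>\<rho>\<in>cbox 0 1. T u = \<rho> + K *v u"
    and const: "\<And>K v s t. K \<in> \<K> \<Longrightarrow> K *v v = v \<Longrightarrow> v $ s = v $ t"
  shows "\<exists>u \<alpha>. \<alpha> \<in> {0..1} \<and> T u = u + vec \<alpha>"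
proof -
  have T0: "T 0 \<in> cbox 0 1" using affine[of 0] by auto
  define \<gamma> where "\<gamma> n = 1 - 1 / real (Suc n)" for n
  have g: "0 \<le> \<gamma> n" "\<gamma> n < 1" for n by (auto simp: \<gamma>_def)
  have "(\<lambda>n. 1 - 1 / real (Suc n)) \<longlonglongrightarrow> 1 - 0"
    using LIMSEQ_inverse_real_of_nat by (intro tendsto_intros) (simp add: inverse_eq_divide)
  then have glim: "\<gamma> \<longlonglongrightarrow> 1" by (simp add: \<gamma>_def[abs_def])
  have "\<exists>w \<alpha>. \<alpha> \<in> {0..1} \<and> (\<forall>s. 0 \<le> w $ s) \<and> (\<Prod>s\<in>UNIV. w $ s) = 0 \<and> T (\<gamma> n *\<^sub>R w) = w + vec \<alpha>" for n
    using topical_relative_values[OF T T0 g[of n]] by metis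
  then obtain w \<alpha> where a: "\<And>n. \<alpha> n \<in> {0..1}" and w0: "\<And>n s. 0 \<le> w n $ s"
    and wz: "\<And>n. (\<Prod>s\<in>UNIV. w n $ s) = 0" and eq: "\<And>n. T (\<gamma> n *\<^sub>R w n) = w n + vec (\<alpha> n)"
    by metis
  \<comment> \<open>Otherwise the norms exceed every bound along indices that tend to infinity, so that the
    discount factors at these indices still tend to one.\<close>
  have "\<exists>N. \<forall>n\<ge>N. norm (w n) \<le> real N"
  proof (rule ccontr)
    assume "\<not> ?thesis"
    then have "\<forall>N. \<exists>n\<ge>N. real N < norm (w n)" by (simp add: not_le)
    then obtain k where k: "\<And>N. k N \<ge> N" "\<And>N. real N < norm (w (k N))" by metis
    have "filterlim k at_top sequentially"
      using k(1) by (intro filterlim_at_top_mono[OF filterlim_ident]) auto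
    then have "(\<lambda>n. \<gamma> (k n)) \<longlonglongrightarrow> 1" by (rule filterlim_compose[OF glim])
    from relative_values_not_unbounded[OF K affine const this, where \<alpha> = "\<lambda>n. \<alpha> (k n)" and w = "\<lambda>n. w (k n)"]
    show False using a w0 wz eq k(2) by simp
  qed
  then obtain N where N: "\<And>n. n \<ge> N \<Longrightarrow> norm (w n) \<le> real N" by blast
  have range: "(w (n + N), \<alpha> (n + N)) \<in> cball 0 (real N) \<times> {0..1}" for n
    using N[of "n + N"] a[of "n + N"] by auto
  have cpt: "compact (cball (0 :: real ^ 's) (real N) \<times> {0..1 :: real})"
    by (intro compact_Times) auto
  obtain l \<sigma> where l: "l \<in> cball 0 (real N) \<times> {0..1}" and \<sigma>: "strict_mono \<sigma>"
    and lim: "((\<lambda>n. (w (n + N), \<alpha> (n + N))) \<circ> \<sigma>) \<longlonglongrightarrow> l"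
    by (rule seq_compactE[OF compact_imp_seq_compact[OF cpt] allI[OF range]])
  obtain u \<beta> where ub: "l = (u, \<beta>)" by (cases l)
  have wu: "(\<lambda>n. w (\<sigma> n + N)) \<longlonglongrightarrow> u" and ab: "(\<lambda>n. \<alpha> (\<sigma> n + N)) \<longlonglongrightarrow> \<beta>"
    using tendsto_fst[OF lim] tendsto_snd[OF lim] by (simp_all add: ub o_def)
  have "(\<lambda>n. \<gamma> (\<sigma> n + N)) \<longlonglongrightarrow> 1"
    using LIMSEQ_subseq_LIMSEQ[OF LIMSEQ_ignore_initial_segment[OF glim, of N] \<sigma>] by (simp add: o_def)
  then have "(\<lambda>n. \<gamma> (\<sigma> n + N) *\<^sub>R w (\<sigma> n + N)) \<longlonglongrightarrow> 1 *\<^sub>R u"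
    by (intro tendsto_intros wu)
  then have "(\<lambda>n. T (\<gamma> (\<sigma> n + N) *\<^sub>R w (\<sigma> n + N))) \<longlonglongrightarrow> T (1 *\<^sub>R u)"
    by (rule continuous_on_tendsto_compose[OF topical_continuous[OF T]]) auto
  then have "(\<lambda>n. w (\<sigma> n + N) + vec (\<alpha> (\<sigma> n + N))) \<longlonglongrightarrow> T u" by (simp add: eq)
  moreover have "(\<lambda>n. w (\<sigma> n + N) + vec (\<alpha> (\<sigma> n + N))) \<longlonglongrightarrow> u + vec \<beta>"
    unfolding vec_def by (intro tendsto_intros wu ab)
  ultimately have "T u = u + vec \<beta>" by (rule LIMSEQ_unique)
  then show ?thesis using l ub by auto
qed

section \<open>The robust Bellman operator\<close>

definition payoff :: "('a::finite \<Rightarrow> real) \<Rightarrow> real ^ 's::finite \<Rightarrow> real ^ 'a \<Rightarrow> real ^ 's ^ 'a \<Rightarrow> real" where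
  "payoff r u \<phi> ps = (\<Sum>a\<in>UNIV. \<Sum>t\<in>UNIV. \<phi> $ a * ps $ a $ t * (r a + u $ t))"

lemma payoff_weights_nonneg:
  "\<phi> \<in> Prob \<Longrightarrow> ps \<in> action_kernels \<Longrightarrow> 0 \<le> \<phi> $ a * ps $ a $ t"
  by (simp add: Prob_def action_kernels_def)

lemma payoff_weights_sum:
  "\<phi> \<in> Prob \<Longrightarrow> ps \<in> action_kernels \<Longrightarrow> (\<Sum>a\<in>UNIV. \<Sum>t\<in>UNIV. \<phi> $ a * ps $ a $ t) = 1"
  by (simp add: Prob_def action_kernels_def flip: sum_distrib_left)

lemma payoff_add_reward:
  assumes "\<phi> \<in> Prob" "ps \<in> action_kernels"
  shows "payoff (\<lambda>a. r a + e) u \<phi> ps = payoff r u \<phi> ps + e"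
proof -
  have "payoff (\<lambda>a. r a + e) u \<phi> ps = payoff r u \<phi> ps + (\<Sum>a\<in>UNIV. \<Sum>t\<in>UNIV. \<phi> $ a * ps $ a $ t) * e"
    by (simp add: payoff_def algebra_simps sum.distrib sum_distrib_left)
  then show ?thesis using payoff_weights_sum[OF assms] by simp
qed

lemma payoff_mono:
  assumes "\<phi> \<in> Prob" "ps \<in> action_kernels" and "\<And>a t. r a + u $ t \<le> r' a + w $ t"
  shows "payoff r u \<phi> ps \<le> payoff r' w \<phi> ps"
  unfolding payoff_def
  by (intro sum_mono mult_left_mono assms payoff_weights_nonneg)

text \<open>
  The affine form of the payoff: an expected reward plus the mean of \<open>u\<close> under the next-state
  distribution. The factors are in the order in which \<open>induced_kernel\<close> has them.
\<close>
lemma payoff_eq_reward_plus_mean: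
  "payoff r u \<phi> ps = payoff r 0 \<phi> ps + (\<Sum>t\<in>UNIV. (\<Sum>a\<in>UNIV. ps $ a $ t * \<phi> $ a) * u $ t)"
proof -
  have "payoff r u \<phi> ps = payoff r 0 \<phi> ps + (\<Sum>a\<in>UNIV. \<Sum>t\<in>UNIV. ps $ a $ t * \<phi> $ a * u $ t)"
    by (simp add: payoff_def algebra_simps sum.distrib)
  then show ?thesis by (subst (asm) sum.swap) (simp add: sum_distrib_right)
qed

text \<open>
  The payoff is monotone in the reward and equals \<open>c\<close> for the constant reward \<open>c\<close> and
  \<open>u = 0\<close>.
\<close>
lemma payoff_zero_bounds:
  assumes "\<phi> \<in> Prob" "ps \<in> action_kernels" "\<And>a. r a \<in> {0..1}"
  shows "0 \<le> payoff r 0 \<phi> ps" "payoff r 0 \<phi> ps \<le> 1"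
proof -
  have const: "payoff (\<lambda>a. c) (0 :: real ^ 'b) \<phi> ps = c" for c
    using payoff_add_reward[OF assms(1,2), of "\<lambda>a. 0" c 0] by (simp add: payoff_def)
  show "0 \<le> payoff r 0 \<phi> ps"
    using payoff_mono[OF assms(1,2), of "\<lambda>a. 0" 0 r 0] assms(3) const[of 0] by simp
  show "payoff r 0 \<phi> ps \<le> 1"
    using payoff_mono[OF assms(1,2), of r 0 "\<lambda>a. 1" 0] assms(3) const[of 1] by simp
qed

lemma stochastic_induced_kernel:
  fixes p :: "'s::finite \<Rightarrow> real ^ 's ^ 'a::finite"
  assumes "\<And>s. p s \<in> action_kernels" "\<And>s. \<Delta> s \<in> Prob"
  shows "stochastic (induced_kernel p \<Delta>)"
  unfolding stochastic_def
proof (intro conjI allI)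
  show "0 \<le> induced_kernel p \<Delta> s t" for s t
    unfolding induced_kernel_def
    by (intro sum_nonneg) (metis mult.commute payoff_weights_nonneg assms)
  have "(\<Sum>t\<in>UNIV. induced_kernel p \<Delta> s t) = (\<Sum>a\<in>UNIV. \<Sum>t\<in>UNIV. \<Delta> s $ a * p s $ a $ t)" for s
    unfolding induced_kernel_def by (subst sum.swap) (simp add: mult.commute)
  then show "(\<Sum>t\<in>UNIV. induced_kernel p \<Delta> s t) = 1" for s
    using payoff_weights_sum[OF assms(2,1)] by simp
qed

lemma compact_vector_box:
  fixes R :: "'n::finite \<Rightarrow> ('b::euclidean_space) set"
  assumes "\<And>i. compact (R i)"
  shows "compact {x :: 'b ^ 'n. \<forall>i. x $ i \<in> R i}"
proof -
  have "\<exists>B. \<forall>y\<in>R i. norm y \<le> B" for i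
    using compact_imp_bounded[OF assms, of i] unfolding bounded_iff .
  then obtain B where B: "\<And>i y. y \<in> R i \<Longrightarrow> norm y \<le> B i" by metis
  have "norm x \<le> (\<Sum>i\<in>UNIV. B i)" if "\<forall>i. x $ i \<in> R i" for x :: "'b ^ 'n"
  proof -
    have "norm x \<le> (\<Sum>i\<in>UNIV. norm (x $ i))"
      unfolding norm_vec_def by (rule L2_set_le_sum) simp
    also have "\<dots> \<le> (\<Sum>i\<in>UNIV. B i)" using B that by (intro sum_mono) auto
    finally show ?thesis .
  qed
  then have "bounded {x :: 'b ^ 'n. \<forall>i. x $ i \<in> R i}" unfolding bounded_iff by blast
  moreover have "closed {x :: 'b ^ 'n. \<forall>i. x $ i \<in> R i}"
    using assms by (intro closed_vector_box) (auto intro: compact_imp_closed)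
  ultimately show ?thesis by (simp add: compact_eq_bounded_closed)
qed

definition induced_row :: "real ^ 's::finite ^ 'a::finite \<Rightarrow> real ^ 'a \<Rightarrow> real ^ 's" where
  "induced_row ps \<phi> = (\<chi> t. \<Sum>a\<in>UNIV. ps $ a $ t * \<phi> $ a)"

lemma induced_row_nth: "induced_row (p s) (\<Delta> s) $ t = induced_kernel p \<Delta> s t"
  by (simp add: induced_row_def induced_kernel_def)

text \<open>
  Kernels and policies are chosen state by state, so the induced kernels are exactly the
  matrices whose rows are chosen independently from sets of this form.
\<close>
lemma compact_induced_rows:
  fixes Q :: "(real ^ 'a::finite) set" and X :: "(real ^ 's::finite ^ 'a) set"
  assumes "compact Q" "compact X"
  shows "compact ((\<lambda>y. induced_row (fst y) (snd y)) ` (X \<times> Q))"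
  unfolding induced_row_def
  by (intro compact_continuous_image continuous_intros compact_Times assms)

theorem corollary7p2:
  fixes r :: "'s::finite \<Rightarrow> 'a::finite \<Rightarrow> real"
    and Q :: "(real ^ 'a) set"
    and P :: "'s \<Rightarrow> (real ^ 's ^ 'a) set"
  assumes "\<forall>s a. r s a \<in> {0..1}"
    and "Q \<subseteq> Prob" and "Q \<noteq> {}"
    and "\<forall>s. P s \<subseteq> action_kernels" and "\<forall>s. P s \<noteq> {}"
    and "compact Q" and "\<forall>s. compact (P s)"
    and "\<forall>p\<in>Pi UNIV P. controlled_unichain Q p"
  shows "\<exists>(u :: 's \<Rightarrow> real) (\<alpha> :: real). \<alpha> \<in> {0..1} \<and>
    (\<forall>s. u s = (SUP \<phi>\<in>Q. INF ps\<in>P s.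
       \<Sum>a\<in>UNIV. \<Sum>s'\<in>UNIV. \<phi> $ a * ps $ a $ s' * (r s a - \<alpha> + u s')))"
proof -
  have Q: "\<phi> \<in> Prob" if "\<phi> \<in> Q" for \<phi> using assms(2) that by blast
  have P: "ps \<in> action_kernels" if "ps \<in> P s" for ps s using assms(4) that by blast
  have "\<exists>v. is_maxmin Q (P s) (payoff (r s) u) v" for s u
    by (rule compact_maxmin_exists) (use assms in \<open>auto simp: payoff_def intro!: continuous_intros\<close>)
  then obtain V where V: "\<And>s u. is_maxmin Q (P s) (payoff (r s) u) (V s u)" by metis
  define T where "T u = (\<chi> s. V s u)" for u
  have T: "is_maxmin Q (P s) (payoff (r s) u) (T u $ s)" for s u using V by (simp add: T_def)
  have "topical T"
    unfolding topical_def
  proof (intro allI impI)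
    fix u w :: "real ^ 's" and e s assume le: "\<forall>s. u $ s \<le> w $ s + e"
    show "T u $ s \<le> T w $ s + e"
    proof (rule is_maxmin_mono[OF T T])
      fix \<phi> ps assume "\<phi> \<in> Q" "ps \<in> P s"
      then have "payoff (r s) u \<phi> ps \<le> payoff (\<lambda>a. r s a + e) w \<phi> ps"
        using le by (intro payoff_mono Q P) (auto simp: algebra_simps)
      then show "payoff (r s) u \<phi> ps \<le> payoff (r s) w \<phi> ps + e"
        using payoff_add_reward[OF Q P] \<open>\<phi> \<in> Q\<close> \<open>ps \<in> P s\<close> by metis
    qed
  qed
  moreover
  \<comment> \<open>The matrices induced by a kernel in \<open>P\<close> and a policy with values in \<open>Q\<close>, row by row.\<close>
  define R where "R s = (\<lambda>y. induced_row (fst y) (snd y)) ` (P s \<times> Q)" for s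
  define \<K> where "\<K> = {K :: real ^ 's ^ 's. \<forall>s. K $ s \<in> R s}"
  have "compact \<K>"
    unfolding \<K>_def R_def using assms(6,7) by (intro compact_vector_box compact_induced_rows) auto
  moreover have "\<exists>K\<in>\<K>. \<exists>\<rho>\<in>cbox 0 1. T u = \<rho> + K *v u" for u
  proof -
    have "\<exists>\<phi> ps. \<phi> \<in> Q \<and> ps \<in> P s \<and> T u $ s = payoff (r s) u \<phi> ps" for s
      using is_maxmin_attained[OF T[of s u]] by metis
    then obtain \<Delta> p where \<Delta>p: "\<And>s. \<Delta> s \<in> Q" "\<And>s. p s \<in> P s"
      "\<And>s. T u $ s = payoff (r s) u (\<Delta> s) (p s)" by metis
    \<comment> \<open>An optimal action distribution and a worst-case kernel at each state represent \<open>T u\<close>.\<close>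
    let ?K = "\<chi> s. induced_row (p s) (\<Delta> s)"
    let ?\<rho> = "\<chi> s. payoff (r s) 0 (\<Delta> s) (p s)"
    have "?K \<in> \<K>" using \<Delta>p by (force simp: \<K>_def R_def)
    moreover have "?\<rho> \<in> cbox 0 1"
      using payoff_zero_bounds[OF Q[OF \<Delta>p(1)] P[OF \<Delta>p(2)]] assms(1) by (simp add: mem_box_cart)
    moreover have "T u = ?\<rho> + ?K *v u"
      unfolding vec_eq_iff
    proof
      fix s
      show "T u $ s = (?\<rho> + ?K *v u) $ s"
        unfolding \<Delta>p(3) by (subst payoff_eq_reward_plus_mean) (simp add: matrix_vector_mult_def induced_row_def)
    qed
    ultimately show ?thesis by blast
  qed
  moreover have "v $ s = v $ t" if K: "K \<in> \<K>" and v: "K *v v = v" for K v s t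
  proof -
    have "\<exists>ps\<in>P s. \<exists>\<phi>\<in>Q. K $ s = induced_row ps \<phi>" for s
    proof -
      have "K $ s \<in> R s" using K by (simp add: \<K>_def)
      then obtain y where "K $ s = induced_row (fst y) (snd y)" "y \<in> P s \<times> Q"
        unfolding R_def by (rule imageE)
      then show ?thesis by (intro bexI[of _ "fst y"] bexI[of _ "snd y"]) auto
    qed
    then obtain p \<Delta> where p\<Delta>: "\<And>s. p s \<in> P s" "\<And>s. \<Delta> s \<in> Q"
      "\<And>s. K $ s = induced_row (p s) (\<Delta> s)" by metis
    have "stochastic (induced_kernel p \<Delta>)"
      using p\<Delta> by (intro stochastic_induced_kernel) (auto intro: P Q)
    moreover have "unichain (induced_kernel p \<Delta>)"
      using assms(8) p\<Delta> unfolding controlled_unichain_def by blast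
    moreover have "(\<Sum>t\<in>UNIV. induced_kernel p \<Delta> s t * v $ t) = v $ s" for s
      using arg_cong[OF v, of "\<lambda>x. x $ s"] p\<Delta>(3)[of s]
      by (simp add: matrix_vector_mult_def induced_row_nth)
    ultimately show ?thesis by (rule unichain_harmonic_const)
  qed
  ultimately have "\<exists>u \<alpha>. \<alpha> \<in> {0..1} \<and> T u = u + vec \<alpha>"
    by (rule topical_additive_eigenvector)
  then obtain u \<alpha> where \<alpha>: "\<alpha> \<in> {0..1}" and eq: "T u = u + vec \<alpha>" by blast
  have "u $ s = (SUP \<phi>\<in>Q. INF ps\<in>P s. payoff (\<lambda>a. r s a - \<alpha>) u \<phi> ps)" for s
  proof (rule is_maxmin_SUP_INF[symmetric])
    have "is_maxmin Q (P s) (payoff (r s) u) (u $ s + \<alpha>)" using T[of s u] eq by simp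
    moreover have "payoff (\<lambda>a. r s a - \<alpha>) u \<phi> ps = payoff (r s) u \<phi> ps - \<alpha>"
      if "\<phi> \<in> Q" "ps \<in> P s" for \<phi> ps
      using payoff_add_reward[OF Q P, OF that, of "r s" "- \<alpha>" u] by simp
    ultimately show "is_maxmin Q (P s) (payoff (\<lambda>a. r s a - \<alpha>) u) (u $ s)"
      unfolding is_maxmin_def by (simp add: le_diff_eq diff_le_eq)
    show "bdd_below (payoff (\<lambda>a. r s a - \<alpha>) u \<phi> ` P s)" for \<phi>
      using assms(7) unfolding payoff_def
      by (intro bounded_imp_bdd_below compact_imp_bounded compact_continuous_image continuous_intros) auto
  qed
  then show ?thesis
    unfolding payoff_def using \<alpha> by blast
qed

end
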